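(* Consider the dice-game stochastic game with state space $S$, action sets $A^s,B^s$, payoffs $r^s$ and transition probabilities $P_{s,a,b}$ described in the context. Then: (i) The game is transient with final state $s_f$. That is, $r^{s_f}(a,b)=0$ and $P_{s_f,a,b}(s_f)=1$ for all $a\in A^{s_f}$, $b\in B^{s_f}$, and for every pair $(\pi,\varphi)\in\Pi\times\Phi$ of behaviour strategies and every initial state $s\in S$, $$\sum_{t=0}^\infty \mathbf{P}_{s,\pi,\varphi}(S_t\neq s_f)<\infty .$$ (ii) The game has a value: for every $s\in S$, $$\sup_{\pi\in\Pi}\inf_{\varphi\in\Phi}V_{\pi,\varphi}(s)=\inf_{\varphi\in\Phi}\sup_{\pi\in\Pi}V_{\pi,\varphi}(s)=:v(s).$$ (iii) The vector $(v(s))_{s\in S}$ is the unique $x\in\mathbb{R}^S$ satisfying $x=\mathrm{U}x$, where $\mathrm{U}:\mathbb{R}^S\to\mathbb{R}^S$ is defined by $$\mathrm{U}x(s)=\begin{cases} \frac12 x(1,0,0,0)+\frac12 x(2,0,0,0) & \text{if } s=s_0,\\ x(1,\alpha,\beta,0)_{\mathrm{roll}} & \text{if } s=(1,\alpha,\beta,0),\\ \max\{x(1,\alpha,\beta,\tau)_{\mathrm{stop}},\,x(1,\alpha,\beta,\tau)_{\mathrm{roll}}\} & \text{if } s=(1,\alpha,\beta,\tau),\ \tau>0,\ \alpha+\tau<200,\\ 1 & \text{if } s=(1,\alpha,\beta,\tau),\ \alpha+\tau\ge 200,\\ x(2,\alpha,\beta,0)_{\mathrm{roll}} & \text{if } s=(2,\alpha,\beta,0),\\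 \min\{x(2,\alpha,\beta,\tau)_{\mathrm{stop}},\,x(2,\alpha,\beta,\tau)_{\mathrm{roll}}\} & \text{if } s=(2,\alpha,\beta,\tau),\ \tau>0,\ \beta+\tau<200,\\ 0 & \text{otherwise,} \end{cases}$$ with $$x(1,\alpha,\beta,\tau)_{\mathrm{roll}}=\tfrac16 x(2,\alpha,\beta,0)+\tfrac16\sum_{k=2}^6 x(1,\alpha,\beta,\tau+k),\qquad x(1,\alpha,\beta,\tau)_{\mathrm{stop}}=x(2,\alpha+\tau,\beta,0),$$ $$x(2,\alpha,\beta,\tau)_{\mathrm{roll}}=\tfrac16 x(1,\alpha,\beta,0)+\tfrac16\sum_{k=2}^6 x(2,\alpha,\beta,\tau+k),\qquad x(2,\alpha,\beta,\tau)_{\mathrm{stop}}=x(1,\alpha,\beta+\tau,0).$$ (iv) Both players have optimal strategies, in the class of all behaviour strategies, that are pure and stationary. Namely, every pure stationary strategy of player one which in each state $(1,\alpha,\beta,\tau)$ with $0<\tau<200-\alpha$ chooses an action in $\{\text{roll},\text{stop}\}$ attaining $\max\{v(1,\alpha,\beta,\tau)_{\mathrm{stop}},v(1,\alpha,\beta,\tau)_{\mathrm{roll}}\}$ (and takes the only available action in every other state) is optimal for player one. Every pure stationary strategy of player two which in each state $(2,\alpha,\beta,\tau)$ with $0<\tau<200-\beta$ chooses an action attaining $\min\{v(2,\alpha,\beta,\tau)_{\mathrm{stop}},v(2,\alpha,\beta,\tau)_{\mathrm{roll}}\}$ (and takes the only available action in every other state) is optimal for player two.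
   Context: **Stochastic games.** A (two-player, zero-sum, finite) stochastic game consists of a finite set $S$ of states; for each $s\in S$, finite action sets $A^s$ (player one) and $B^s$ (player two); payoff functions $r^s:A^s\times B^s\to\mathbb{R}$ (the amount player two pays player one); and, for each $(s,a,b)$ with $s\in S$, $a\in A^s$, $b\in B^s$, a probability distribution $P_{s,a,b}$ on $S$ governing the next state. At each time $t=0,1,\dots$, in state $S_t$, the players simultaneously and independently choose actions $A_t\in A^{S_t}$, $B_t\in B^{S_t}$. Let $\mathbb{K}=\{(s,a,b): s\in S, a\in A^s, b\in B^s\}$, and let $\mathbb{H}_0=S$, $\mathbb{H}_t=\mathbb{K}^t\times S$ for $t\ge1$ (admissible histories up to time $t$). A behaviour strategy $\pi$ of player one (resp. $\varphi$ of player two) assigns to each history $h=(s_0,a_0,b_0,\dots,s)\in\bigcup_{t\ge 0}\mathbb{H}_t$ with last state $s$ a probability distribution $\pi(\cdot|h)$ on $A^s$ (resp. $\varphi(\cdot|h)$ on $B^s$). $\Pi$ and $\Phi$ denote the sets of all behaviour strategies of players one and two. A strategy is pure if for each $h$ it assigns probability 1 to a single action, and stationary if the distribution it assigns depends only on the last state of $h$. For $s\in S$, $\pi\in\Pi$, $\varphi\in\Phi$, $\mathbf{P}_{s,\pi,\varphi}$ (with expectation $\mathbf{E}_{s,\pi,\varphi}$) is the law of the process $(S_t,A_t,B_t)_{t\ge0}$ with $S_0=s$, with $A_t,B_t$ conditionally independent given the history $H_t=(S_0,A_0,B_0,\dots,S_t)$ with conditional laws $\pi(\cdot|H_t)$ and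 $\varphi(\cdot|H_t)$, and with $S_{t+1}$ having conditional law $P_{S_t,A_t,B_t}$ given $(H_t,A_t,B_t)$. In a transient game, put $$V_{\pi,\varphi}(s)=\sum_{t=0}^\infty\mathbf{E}_{s,\pi,\varphi}\big(r^{S_t}(A_t,B_t)\big).$$ A strategy $\pi^*\in\Pi$ is optimal for player one if $\inf_{\varphi\in\Phi}V_{\pi^*,\varphi}(s)=\sup_{\pi\in\Pi}\inf_{\varphi\in\Phi}V_{\pi,\varphi}(s)$ for all $s\in S$. A strategy $\varphi^*\in\Phi$ is optimal for player two if $\sup_{\pi\in\Pi}V_{\pi,\varphi^*}(s)=\inf_{\varphi\in\Phi}\sup_{\pi\in\Pi}V_{\pi,\varphi}(s)$ for all $s\in S$. **The dice game.** Two players roll a die by turns, with target 200. In a turn a player rolls repeatedly until stopping (the turn score is then added to his account) or rolling an ace (nothing is added); the die then passes to the opponent. In a state $(j,\alpha,\beta,\tau)$, $j$ is the player holding the die, $\alpha,\beta$ are the accumulated scores of players one and two, and $\tau$ is the current turn score of player $j$. Formally (all coordinates being integers): *States.* $S=\{s_0,s_f\}\cup S_1\cup S_2$, where $s_0$ is a special initial state, $s_f$ a special final state, $$S_1=\{(1,\alpha,\beta,\tau):0\le\alpha\le199,\ 0\le\beta\le199,\ 0\le\tau\le205-\alpha\},$$ $$S_2=\{(2,\alpha,\beta,\tau):0\le\alpha\le199,\ 0\le\beta\le199,\ 0\le\tau\le205-\beta\}.$$ *Actions.* In $s_0$ and $s_f$ both players have the single action "wait". In states of $S_1$ player two has the single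 action "wait", while player one has action set $\{\text{roll}\}$ if $\tau=0$, $\{\text{roll},\text{stop}\}$ if $0<\tau<200-\alpha$, and $\{\text{stop}\}$ if $\tau\ge200-\alpha$. In states of $S_2$ player one has the single action "wait", while player two has action set $\{\text{roll}\}$ if $\tau=0$, $\{\text{roll},\text{stop}\}$ if $0<\tau<200-\beta$, and $\{\text{stop}\}$ if $\tau\ge200-\beta$. *Payoffs.* $r^s(a,b)=1$ if $s=(1,\alpha,\beta,\tau)$ with $\alpha+\tau\ge200$, and $r^s(a,b)=0$ for every other state $s$ (for all available actions $a,b$). *Transitions.* From $s_0$: to $(1,0,0,0)$ and to $(2,0,0,0)$, each with probability $1/2$. From $s_f$: to $s_f$ with probability 1. From $(1,\alpha,\beta,\tau)$ with $\alpha+\tau<200$: under "roll", to $(2,\alpha,\beta,0)$ with probability $1/6$ and to $(1,\alpha,\beta,\tau+k)$ with probability $1/6$ for each $k=2,\dots,6$; under "stop", to $(2,\alpha+\tau,\beta,0)$ with probability 1. From $(1,\alpha,\beta,\tau)$ with $\alpha+\tau\ge200$: to $s_f$ with probability 1. Symmetrically, from $(2,\alpha,\beta,\tau)$ with $\beta+\tau<200$: under "roll", to $(1,\alpha,\beta,0)$ with probability $1/6$ and to $(2,\alpha,\beta,\tau+k)$ with probability $1/6$ for each $k=2,\dots,6$; under "stop", to $(1,\alpha,\beta+\tau,0)$ with probability 1. From $(2,\alpha,\beta,\tau)$ with $\beta+\tau\ge200$: to $s_f$ with probability 1. *)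

theory Defs
  imports "HOL-Probability.Probability"
begin

section \<open>Finite two-player zero-sum stochastic games\<close>

text \<open>
  A history is a pair of the list of past (state, action, action) triples and the current state;
  a behaviour strategy maps histories to distributions over actions.
\<close>

type_synonym ('s, 'a, 'b) hist = "('s \<times> 'a \<times> 'b) list \<times> 's"
type_synonym ('s, 'a, 'b, 'c) strategy = "('s, 'a, 'b) hist \<Rightarrow> 'c pmf"

text \<open>
  The types are countable so that the discrete \<open>\<sigma>\<close>-algebra can be used for a single stage; the
  sets of states and actions themselves are finite.
\<close>

locale stochastic_game =
  fixes S :: "'s::countable set"
    and A :: "'s \<Rightarrow> 'a::countable set"
    and B :: "'s \<Rightarrow> 'b::countable set"
    and r :: "'s \<Rightarrow> 'a \<Rightarrow> 'b \<Rightarrow> real"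
    and P :: "'s \<Rightarrow> 'a \<Rightarrow> 'b \<Rightarrow> 's pmf"
  assumes finite_states: "finite S"
    and finite_actions1: "s \<in> S \<Longrightarrow> finite (A s)"
    and finite_actions2: "s \<in> S \<Longrightarrow> finite (B s)"
    and actions1_nonempty: "s \<in> S \<Longrightarrow> A s \<noteq> {}"
    and actions2_nonempty: "s \<in> S \<Longrightarrow> B s \<noteq> {}"
    and transitions: "s \<in> S \<Longrightarrow> a \<in> A s \<Longrightarrow> b \<in> B s \<Longrightarrow> set_pmf (P s a b) \<subseteq> S"
begin

definition K :: "('s \<times> 'a \<times> 'b) set" where
  "K = {(s, a, b). s \<in> S \<and> a \<in> A s \<and> b \<in> B s}"

definition histories :: "('s, 'a, 'b) hist set" where
  "histories = lists K \<times> S"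

text \<open>Values of a strategy outside \<^term>\<open>histories\<close> are irrelevant and left unconstrained.\<close>

definition strategies1 :: "('s, 'a, 'b, 'a) strategy set" where
  "strategies1 = {\<pi>. \<forall>h\<in>histories. set_pmf (\<pi> h) \<subseteq> A (snd h)}"

definition strategies2 :: "('s, 'a, 'b, 'b) strategy set" where
  "strategies2 = {\<phi>. \<forall>h\<in>histories. set_pmf (\<phi> h) \<subseteq> B (snd h)}"

definition pure :: "('s, 'a, 'b, 'c) strategy \<Rightarrow> bool" where
  "pure \<sigma> \<longleftrightarrow> (\<forall>h\<in>histories. \<exists>c. \<sigma> h = return_pmf c)"

definition stationary :: "('s, 'a, 'b, 'c) strategy \<Rightarrow> bool" where
  "stationary \<sigma> \<longleftrightarrow> (\<forall>h\<in>histories. \<forall>h'\<in>histories. snd h = snd h' \<longrightarrow> \<sigma> h = \<sigma> h')"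

subsection \<open>The law of the play\<close>

text \<open>
  \<open>stage s \<pi> \<phi> ks\<close> is the conditional law of \<open>(S\<^sub>t, A\<^sub>t, B\<^sub>t)\<close> when \<open>ks\<close> lists the outcomes of the
  stages \<open>0, \<dots>, t - 1\<close> and the initial state is \<open>s\<close>. The law of the whole play, a measure on
  infinite sequences of stage outcomes, is obtained from these kernels by the Ionescu-Tulcea
  extension.
\<close>

definition stage ::
  "'s \<Rightarrow> ('s, 'a, 'b, 'a) strategy \<Rightarrow> ('s, 'a, 'b, 'b) strategy \<Rightarrow>
    ('s \<times> 'a \<times> 'b) list \<Rightarrow> ('s \<times> 'a \<times> 'b) pmf" where
  "stage s \<pi> \<phi> ks =
    bind_pmf (if ks = [] then return_pmf s else (case last ks of (s', a, b) \<Rightarrow> P s' a b)) (\<lambda>s'.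
    bind_pmf (\<pi> (ks, s')) (\<lambda>a.
    bind_pmf (\<phi> (ks, s')) (\<lambda>b.
    return_pmf (s', a, b))))"

definition kernel ::
  "'s \<Rightarrow> ('s, 'a, 'b, 'a) strategy \<Rightarrow> ('s, 'a, 'b, 'b) strategy \<Rightarrow>
    nat \<Rightarrow> (nat \<Rightarrow> 's \<times> 'a \<times> 'b) \<Rightarrow> ('s \<times> 'a \<times> 'b) measure" where
  "kernel s \<pi> \<phi> t \<omega> = measure_pmf (stage s \<pi> \<phi> (map \<omega> [0..<t]))"

definition law ::
  "'s \<Rightarrow> ('s, 'a, 'b, 'a) strategy \<Rightarrow> ('s, 'a, 'b, 'b) strategy \<Rightarrow>
    (nat \<Rightarrow> 's \<times> 'a \<times> 'b) measure" where
  "law s \<pi> \<phi> =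
    projective_family.lim UNIV
      (Ionescu_Tulcea.CI (kernel s \<pi> \<phi>) (\<lambda>_. count_space UNIV)) (\<lambda>_. count_space UNIV)"

lemma Ionescu_Tulcea_kernel: "Ionescu_Tulcea (kernel s \<pi> \<phi>) (\<lambda>_. count_space UNIV)"
proof (rule Ionescu_Tulcea.intro)
  fix i :: nat
  have "PiM {0..<i} (\<lambda>_. count_space (UNIV :: ('s \<times> 'a \<times> 'b) set)) =
      count_space (PiE {0..<i} (\<lambda>_. UNIV))"
    by (rule count_space_PiM_finite) auto
  then show "kernel s \<pi> \<phi> i \<in> PiM {0..<i} (\<lambda>_. count_space UNIV) \<rightarrow>\<^sub>M subprob_algebra (count_space UNIV)"
    by (simp add: kernel_def measure_pmf_in_subprob_algebra)
qed (simp add: kernel_def prob_space_measure_pmf)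

text \<open>The finite-dimensional marginals of \<^const>\<open>law\<close> are the intended ones.\<close>

primrec marginal ::
  "'s \<Rightarrow> ('s, 'a, 'b, 'a) strategy \<Rightarrow> ('s, 'a, 'b, 'b) strategy \<Rightarrow>
    nat \<Rightarrow> ('s \<times> 'a \<times> 'b) list pmf" where
  "marginal s \<pi> \<phi> 0 = return_pmf []"
| "marginal s \<pi> \<phi> (Suc t) =
    bind_pmf (marginal s \<pi> \<phi> t) (\<lambda>ks. map_pmf (\<lambda>k. ks @ [k]) (stage s \<pi> \<phi> ks))"

context
  fixes s :: 's and \<pi> :: "('s, 'a, 'b, 'a) strategy" and \<phi> :: "('s, 'a, 'b, 'b) strategy"
begin

interpretation IT: Ionescu_Tulcea "kernel s \<pi> \<phi>" "\<lambda>_. count_space UNIV"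
  by (rule Ionescu_Tulcea_kernel)

lemma prob_space_law: "prob_space (law s \<pi> \<phi>)"
proof -
  have "emeasure IT.PF.lim (prod_emb UNIV (\<lambda>_. count_space UNIV) {} (space (PiM {} (\<lambda>_. count_space UNIV))))
      = emeasure (IT.CI {}) (space (PiM {} (\<lambda>_. count_space UNIV)))"
    by (rule IT.lim) auto
  also have "\<dots> = 1"
    using prob_space.emeasure_space_1[OF IT.PF.prob_space_P[of "{}"]] by (simp add: IT.PF.space_P)
  also have "prod_emb UNIV (\<lambda>_. count_space UNIV) {} (space (PiM {} (\<lambda>_. count_space (UNIV :: ('s \<times> 'a \<times> 'b) set)))) =
      space IT.PF.lim"
    by (auto simp: prod_emb_def space_PiM)
  finally show ?thesis
    unfolding law_def by (rule prob_spaceI)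
qed

lemma distr_law:
  "distr (law s \<pi> \<phi>) (count_space UNIV) (\<lambda>\<omega>. map \<omega> [0..<t]) = measure_pmf (marginal s \<pi> \<phi> t)"
proof -
  let ?M = "\<lambda>_::nat. count_space (UNIV :: ('s \<times> 'a \<times> 'b) set)"
  let ?l = "\<lambda>n (\<omega> :: nat \<Rightarrow> 's \<times> 'a \<times> 'b). map \<omega> [0..<n]"
  have PiM_eq: "PiM {0..<n} ?M = count_space (PiE {0..<n} (\<lambda>_. UNIV))" for n
    by (rule count_space_PiM_finite) auto
  have ml: "?l n \<in> PiM {0..<n} ?M \<rightarrow>\<^sub>M count_space UNIV" for n
    by (simp add: PiM_eq)
  let ?u = "\<lambda>_::nat. undefined :: 's \<times> 'a \<times> 'b"
  have u: "?u \<in> space (PiM {0..<0} ?M)"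
    by (simp add: space_PiM)
  have C: "distr (IT.C 0 n ?u) (count_space UNIV) (?l n) = measure_pmf (marginal s \<pi> \<phi> n)" for n
  proof (induction n)
    case 0
    show ?case
      using distr_return[OF ml[of 0] u] by (simp add: return_pmf.rep_eq)
  next
    case (Suc n)
    let ?k = "\<lambda>ks. measure_pmf (map_pmf (\<lambda>k. ks @ [k]) (stage s \<pi> \<phi> ks))"
    have step: "distr (IT.eP n \<omega>) (count_space UNIV) (?l (Suc n)) = ?k (?l n \<omega>)"
      if "\<omega> \<in> space (PiM {0..<n} ?M)" for \<omega>
    proof -
      have fu: "fun_upd \<omega> n \<in> kernel s \<pi> \<phi> n \<omega> \<rightarrow>\<^sub>M PiM {0..<Suc n} ?M"
        using that by (auto simp: kernel_def PiM_eq space_PiM PiE_iff extensional_def)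
      have "distr (IT.eP n \<omega>) (count_space UNIV) (?l (Suc n)) =
          distr (kernel s \<pi> \<phi> n \<omega>) (count_space UNIV) (?l (Suc n) \<circ> fun_upd \<omega> n)"
        unfolding IT.eP_def by (rule distr_distr[OF ml fu])
      also have "?l (Suc n) \<circ> fun_upd \<omega> n = (\<lambda>k. ?l n \<omega> @ [k])"
        by (auto simp: fun_eq_iff)
      finally have "distr (IT.eP n \<omega>) (count_space UNIV) (?l (Suc n)) =
          distr (kernel s \<pi> \<phi> n \<omega>) (count_space UNIV) (\<lambda>k. ?l n \<omega> @ [k])" .
      also have "\<dots> = ?k (?l n \<omega>)"
        by (simp only: kernel_def map_pmf_rep_eq)
      finally show ?thesis .
    qed
    have sets_C: "sets (IT.C 0 n ?u) = sets (PiM {0..<n} ?M)"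
      using IT.sets_C[OF u, of n] by simp
    have space_C: "space (IT.C 0 n ?u) = space (PiM {0..<n} ?M)"
      using sets_C by (rule sets_eq_imp_space_eq)
    have meP: "IT.eP n \<in> IT.C 0 n ?u \<rightarrow>\<^sub>M subprob_algebra (PiM {0..<Suc n} ?M)"
      by (subst measurable_cong_sets[OF sets_C refl]) (rule IT.measurable_eP)
    have ml': "?l n \<in> IT.C 0 n ?u \<rightarrow>\<^sub>M count_space UNIV"
      by (subst measurable_cong_sets[OF sets_C refl]) (rule ml)
    have ne: "space (IT.C 0 n ?u) \<noteq> {}"
      by (simp add: space_C space_PiM PiE_eq_empty_iff)
    have mk: "?k \<in> count_space UNIV \<rightarrow>\<^sub>M subprob_algebra (count_space UNIV)"
      by (simp add: measure_pmf_in_subprob_algebra)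
    have "distr (IT.C 0 (Suc n) ?u) (count_space UNIV) (?l (Suc n)) =
        IT.C 0 n ?u \<bind> (\<lambda>\<omega>. distr (IT.eP n \<omega>) (count_space UNIV) (?l (Suc n)))"
      using distr_bind[OF meP ne ml[of "Suc n"]] by simp
    also have "\<dots> = IT.C 0 n ?u \<bind> (\<lambda>\<omega>. ?k (?l n \<omega>))"
      by (rule bind_cong[OF refl]) (simp only: step space_C)
    also have "\<dots> = distr (IT.C 0 n ?u) (count_space UNIV) (?l n) \<bind> ?k"
      by (rule bind_distr[OF ml' mk ne, symmetric])
    also have "\<dots> = measure_pmf (marginal s \<pi> \<phi> (Suc n))"
      by (simp add: Suc.IH measure_pmf_bind)
    finally show ?case .
  qed
  have res: "(\<lambda>\<omega>. restrict \<omega> {0..<t}) \<in> law s \<pi> \<phi> \<rightarrow>\<^sub>M PiM {0..<t} ?M"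
    unfolding law_def
    by (subst measurable_cong_sets[OF IT.PF.sets_lim refl]) (rule measurable_restrict_subset, simp)
  have "distr (law s \<pi> \<phi>) (count_space UNIV) (?l t) =
      distr (law s \<pi> \<phi>) (count_space UNIV) (?l t \<circ> (\<lambda>\<omega>. restrict \<omega> {0..<t}))"
    by (rule arg_cong[where f="distr _ _"]) (auto simp: fun_eq_iff)
  also have "\<dots> = distr (distr (law s \<pi> \<phi>) (PiM {0..<t} ?M) (\<lambda>\<omega>. restrict \<omega> {0..<t})) (count_space UNIV) (?l t)"
    by (rule distr_distr[OF ml res, symmetric])
  also have "distr (law s \<pi> \<phi>) (PiM {0..<t} ?M) (\<lambda>\<omega>. restrict \<omega> {0..<t}) = IT.CI {0..<t}"
    unfolding law_def by (rule IT.distr_lim) simp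
  also have "\<dots> = IT.C 0 t ?u"
  proof (rule measure_eqI)
    show sets: "sets (IT.CI {0..<t}) = sets (IT.C 0 t ?u)"
      using IT.sets_C[OF u, of t] by (simp add: IT.PF.sets_P)
    fix X assume X: "X \<in> sets (IT.CI {0..<t})"
    then have X': "X \<in> sets (PiM {0..<t} ?M)"
      by (simp add: IT.PF.sets_P)
    show "emeasure (IT.CI {0..<t}) X = emeasure (IT.C 0 t ?u) X"
      using IT.emeasure_CI[OF order_refl X'] sets.sets_into_space[OF X']
      by (simp add: prod_emb_id space_PiM)
  qed
  also note C
  finally show ?thesis .
qed

end

subsection \<open>Transience, payoff and optimality\<close>

definition transient :: "'s \<Rightarrow> bool" where
  "transient f \<longleftrightarrow> f \<in> S \<and>
    (\<forall>a\<in>A f. \<forall>b\<in>B f. r f a b = 0 \<and> pmf (P f a b) f = 1) \<and>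
    (\<forall>\<pi>\<in>strategies1. \<forall>\<phi>\<in>strategies2. \<forall>s\<in>S.
      summable (\<lambda>t. measure (law s \<pi> \<phi>) {\<omega> \<in> space (law s \<pi> \<phi>). fst (\<omega> t) \<noteq> f}))"

definition V :: "('s, 'a, 'b, 'a) strategy \<Rightarrow> ('s, 'a, 'b, 'b) strategy \<Rightarrow> 's \<Rightarrow> real" where
  "V \<pi> \<phi> s = (\<Sum>t. \<integral>\<omega>. (case \<omega> t of (s', a, b) \<Rightarrow> r s' a b) \<partial>law s \<pi> \<phi>)"

definition lower_value :: "'s \<Rightarrow> real" where
  "lower_value s = (SUP \<pi>\<in>strategies1. INF \<phi>\<in>strategies2. V \<pi> \<phi> s)"

definition upper_value :: "'s \<Rightarrow> real" where
  "upper_value s = (INF \<phi>\<in>strategies2. SUP \<pi>\<in>strategies1. V \<pi> \<phi> s)"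

text \<open>The value of the game; only meaningful if the lower and the upper value coincide.\<close>

definition val :: "'s \<Rightarrow> real" where
  "val = lower_value"

definition optimal1 :: "('s, 'a, 'b, 'a) strategy \<Rightarrow> bool" where
  "optimal1 \<pi> \<longleftrightarrow> \<pi> \<in> strategies1 \<and>
    (\<forall>s\<in>S. (INF \<phi>\<in>strategies2. V \<pi> \<phi> s) = lower_value s)"

definition optimal2 :: "('s, 'a, 'b, 'b) strategy \<Rightarrow> bool" where
  "optimal2 \<phi> \<longleftrightarrow> \<phi> \<in> strategies2 \<and>
    (\<forall>s\<in>S. (SUP \<pi>\<in>strategies1. V \<pi> \<phi> s) = upper_value s)"

end

section \<open>The dice game\<close>

text \<open>\<open>Turn1 \<alpha> \<beta> \<tau>\<close> and \<open>Turn2 \<alpha> \<beta> \<tau>\<close> stand for \<open>(1, \<alpha>, \<beta>, \<tau>)\<close> and \<open>(2, \<alpha>, \<beta>, \<tau>)\<close>.\<close>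

datatype dice_state = Start | Final | Turn1 nat nat nat | Turn2 nat nat nat
datatype action = Wait | Roll | Stop

instance dice_state :: countable by countable_datatype
instance action :: countable by countable_datatype

definition dice_states :: "dice_state set" where
  "dice_states = {Start, Final}
    \<union> {Turn1 \<alpha> \<beta> \<tau> | \<alpha> \<beta> \<tau>. \<alpha> \<le> 199 \<and> \<beta> \<le> 199 \<and> \<tau> \<le> 205 - \<alpha>}
    \<union> {Turn2 \<alpha> \<beta> \<tau> | \<alpha> \<beta> \<tau>. \<alpha> \<le> 199 \<and> \<beta> \<le> 199 \<and> \<tau> \<le> 205 - \<beta>}"

text \<open>The actions of the player holding the die, given his score and his turn score.\<close>

definition holder_actions :: "nat \<Rightarrow> nat \<Rightarrow> action set" where
  "holder_actions score \<tau> =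
    (if \<tau> = 0 then {Roll} else if \<tau> < 200 - score then {Roll, Stop} else {Stop})"

fun dice_actions1 :: "dice_state \<Rightarrow> action set" where
  "dice_actions1 (Turn1 \<alpha> \<beta> \<tau>) = holder_actions \<alpha> \<tau>"
| "dice_actions1 _ = {Wait}"

fun dice_actions2 :: "dice_state \<Rightarrow> action set" where
  "dice_actions2 (Turn2 \<alpha> \<beta> \<tau>) = holder_actions \<beta> \<tau>"
| "dice_actions2 _ = {Wait}"

fun dice_payoff :: "dice_state \<Rightarrow> action \<Rightarrow> action \<Rightarrow> real" where
  "dice_payoff (Turn1 \<alpha> \<beta> \<tau>) _ _ = (if \<alpha> + \<tau> \<ge> 200 then 1 else 0)"
| "dice_payoff _ _ _ = 0"

text \<open>
  Every action other than \<^const>\<open>Roll\<close> is treated as \<^const>\<open>Stop\<close> for the player holding the die;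
  this only concerns unavailable actions.
\<close>

fun dice_trans :: "dice_state \<Rightarrow> action \<Rightarrow> action \<Rightarrow> dice_state pmf" where
  "dice_trans Start _ _ = pmf_of_set {Turn1 0 0 0, Turn2 0 0 0}"
| "dice_trans Final _ _ = return_pmf Final"
| "dice_trans (Turn1 \<alpha> \<beta> \<tau>) a _ =
    (if \<alpha> + \<tau> \<ge> 200 then return_pmf Final
     else if a = Roll then
       map_pmf (\<lambda>k. if k = 1 then Turn2 \<alpha> \<beta> 0 else Turn1 \<alpha> \<beta> (\<tau> + k)) (pmf_of_set {1..6})
     else return_pmf (Turn2 (\<alpha> + \<tau>) \<beta> 0))"
| "dice_trans (Turn2 \<alpha> \<beta> \<tau>) _ b =
    (if \<beta> + \<tau> \<ge> 200 then return_pmf Final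
     else if b = Roll then
       map_pmf (\<lambda>k. if k = 1 then Turn1 \<alpha> \<beta> 0 else Turn2 \<alpha> \<beta> (\<tau> + k)) (pmf_of_set {1..6})
     else return_pmf (Turn1 \<alpha> (\<beta> + \<tau>) 0))"

lemma finite_dice_states: "finite dice_states"
proof -
  have "dice_states \<subseteq> {Start, Final}
    \<union> (\<lambda>(\<alpha>, \<beta>, \<tau>). Turn1 \<alpha> \<beta> \<tau>) ` ({..199} \<times> {..199} \<times> {..205})
    \<union> (\<lambda>(\<alpha>, \<beta>, \<tau>). Turn2 \<alpha> \<beta> \<tau>) ` ({..199} \<times> {..199} \<times> {..205})"
    by (force simp: dice_states_def)
  then show ?thesis
    by (rule finite_subset) simp
qed

interpretation dice: stochastic_game dice_states dice_actions1 dice_actions2 dice_payoff dice_trans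
proof
  fix s a b
  assume s: "s \<in> dice_states" and a: "a \<in> dice_actions1 s" and b: "b \<in> dice_actions2 s"
  show "set_pmf (dice_trans s a b) \<subseteq> dice_states"
    using s a b
    by (cases s) (auto simp: dice_states_def holder_actions_def split: if_splits)
next
  fix s assume "s \<in> dice_states"
  show "finite (dice_actions1 s)" "dice_actions1 s \<noteq> {}"
    by (cases s; simp add: holder_actions_def)+
  show "finite (dice_actions2 s)" "dice_actions2 s \<noteq> {}"
    by (cases s; simp add: holder_actions_def)+
qed (rule finite_dice_states)

subsection \<open>The optimality operator\<close>

definition roll1 :: "(dice_state \<Rightarrow> real) \<Rightarrow> nat \<Rightarrow> nat \<Rightarrow> nat \<Rightarrow> real" where
  "roll1 x \<alpha> \<beta> \<tau> = 1/6 * x (Turn2 \<alpha> \<beta> 0) + 1/6 * (\<Sum>k=2..6. x (Turn1 \<alpha> \<beta> (\<tau> + k)))"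

definition stop1 :: "(dice_state \<Rightarrow> real) \<Rightarrow> nat \<Rightarrow> nat \<Rightarrow> nat \<Rightarrow> real" where
  "stop1 x \<alpha> \<beta> \<tau> = x (Turn2 (\<alpha> + \<tau>) \<beta> 0)"

definition roll2 :: "(dice_state \<Rightarrow> real) \<Rightarrow> nat \<Rightarrow> nat \<Rightarrow> nat \<Rightarrow> real" where
  "roll2 x \<alpha> \<beta> \<tau> = 1/6 * x (Turn1 \<alpha> \<beta> 0) + 1/6 * (\<Sum>k=2..6. x (Turn2 \<alpha> \<beta> (\<tau> + k)))"

definition stop2 :: "(dice_state \<Rightarrow> real) \<Rightarrow> nat \<Rightarrow> nat \<Rightarrow> nat \<Rightarrow> real" where
  "stop2 x \<alpha> \<beta> \<tau> = x (Turn1 \<alpha> (\<beta> + \<tau>) 0)"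

text \<open>
  \<open>U x s\<close> for a state \<open>s\<close> only depends on the values of \<open>x\<close> at states, so that \<open>U\<close> is an operator
  on real vectors indexed by \<^const>\<open>dice_states\<close>.
\<close>

fun U :: "(dice_state \<Rightarrow> real) \<Rightarrow> dice_state \<Rightarrow> real" where
  "U x Start = 1/2 * x (Turn1 0 0 0) + 1/2 * x (Turn2 0 0 0)"
| "U x Final = 0"
| "U x (Turn1 \<alpha> \<beta> \<tau>) =
    (if \<tau> = 0 then roll1 x \<alpha> \<beta> 0
     else if \<alpha> + \<tau> < 200 then max (stop1 x \<alpha> \<beta> \<tau>) (roll1 x \<alpha> \<beta> \<tau>)
     else 1)"
| "U x (Turn2 \<alpha> \<beta> \<tau>) =
    (if \<tau> = 0 then roll2 x \<alpha> \<beta> 0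
     else if \<beta> + \<tau> < 200 then min (stop2 x \<alpha> \<beta> \<tau>) (roll2 x \<alpha> \<beta> \<tau>)
     else 0)"

lemma U_cong:
  assumes "s \<in> dice_states" and "\<And>s'. s' \<in> dice_states \<Longrightarrow> x s' = y s'"
  shows "U x s = U y s"
proof -
  have r1: "roll1 x \<alpha> \<beta> \<tau> = roll1 y \<alpha> \<beta> \<tau>" if "\<alpha> + \<tau> < 200" "\<beta> < 200" for \<alpha> \<beta> \<tau>
    using that unfolding roll1_def
    by (intro arg_cong2[where f="(+)"] arg_cong2[where f="(*)"] refl sum.cong assms(2))
      (auto simp: dice_states_def)
  have r2: "roll2 x \<alpha> \<beta> \<tau> = roll2 y \<alpha> \<beta> \<tau>" if "\<beta> + \<tau> < 200" "\<alpha> < 200" for \<alpha> \<beta> \<tau>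
    using that unfolding roll2_def
    by (intro arg_cong2[where f="(+)"] arg_cong2[where f="(*)"] refl sum.cong assms(2))
      (auto simp: dice_states_def)
  have s1: "stop1 x \<alpha> \<beta> \<tau> = stop1 y \<alpha> \<beta> \<tau>" if "\<alpha> + \<tau> < 200" "\<beta> < 200" for \<alpha> \<beta> \<tau>
    using that unfolding stop1_def by (intro assms(2)) (auto simp: dice_states_def)
  have s2: "stop2 x \<alpha> \<beta> \<tau> = stop2 y \<alpha> \<beta> \<tau>" if "\<beta> + \<tau> < 200" "\<alpha> < 200" for \<alpha> \<beta> \<tau>
    using that unfolding stop2_def by (intro assms(2)) (auto simp: dice_states_def)
  have start: "x (Turn1 0 0 0) = y (Turn1 0 0 0)" "x (Turn2 0 0 0) = y (Turn2 0 0 0)"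
    by (intro assms(2); simp add: dice_states_def)+
  show ?thesis
    using assms(1) by (cases s) (auto simp: dice_states_def r1 r2 s1 s2 start)
qed

text \<open>
  The strategy chooses, wherever the player holding the die has two actions, one whose
  continuation value under \<open>x\<close> attains the maximum (minimum) in the operator \<^const>\<open>U\<close>.
\<close>

definition attains_max ::
  "(dice_state, action, action, action) strategy \<Rightarrow> (dice_state \<Rightarrow> real) \<Rightarrow> bool" where
  "attains_max \<pi> x \<longleftrightarrow>
    (\<forall>h \<alpha> \<beta> \<tau>. (h, Turn1 \<alpha> \<beta> \<tau>) \<in> dice.histories \<and> 0 < \<tau> \<and> \<tau> < 200 - \<alpha> \<longrightarrow>
      (let m = max (stop1 x \<alpha> \<beta> \<tau>) (roll1 x \<alpha> \<beta> \<tau>); p = \<pi> (h, Turn1 \<alpha> \<beta> \<tau>)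
       in p = return_pmf Stop \<and> stop1 x \<alpha> \<beta> \<tau> = m \<or> p = return_pmf Roll \<and> roll1 x \<alpha> \<beta> \<tau> = m))"

definition attains_min ::
  "(dice_state, action, action, action) strategy \<Rightarrow> (dice_state \<Rightarrow> real) \<Rightarrow> bool" where
  "attains_min \<phi> x \<longleftrightarrow>
    (\<forall>h \<alpha> \<beta> \<tau>. (h, Turn2 \<alpha> \<beta> \<tau>) \<in> dice.histories \<and> 0 < \<tau> \<and> \<tau> < 200 - \<beta> \<longrightarrow>
      (let m = min (stop2 x \<alpha> \<beta> \<tau>) (roll2 x \<alpha> \<beta> \<tau>); p = \<phi> (h, Turn2 \<alpha> \<beta> \<tau>)
       in p = return_pmf Stop \<and> stop2 x \<alpha> \<beta> \<tau> = m \<or> p = return_pmf Roll \<and> roll2 x \<alpha> \<beta> \<tau> = m))"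

end

theory Submission
  imports Defs
begin

text \<open>
  If a function \<open>x\<close> on the states vanishes at the final state and satisfies \<open>r + P x \<le> x\<close> (\<open>\<ge>\<close>) at every
  action pair that two given strategies can produce, then the payoffs up to time \<open>n\<close> plus the
  expectation of \<open>x(S\<^sub>n)\<close> are at most (at least) \<open>x(s)\<close>, and by transience \<open>E x(S\<^sub>n)\<close> vanishes in the
  limit. For a fixed point \<open>x\<close> of \<open>U\<close> this makes any pair of strategies attaining the maxima and minima
  a saddle point with value \<open>x\<close>, which gives uniqueness, the value and optimality at once. A fixed
  point is the limit of the increasing sequence \<open>U\<^sup>n 0\<close>. Transience itself is the same drift argument
  with payoff \<open>1\<close> off the final state and a Lyapunov function that decreases exponentially in the
  total score.
\<close>

section \<open>Drift conditions along a pair of strategies\<close>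

context stochastic_game
begin

section \<open>Laws of single stages of the play\<close>

lemma sets_law: "sets (law s \<pi> \<phi>) = sets (PiM UNIV (\<lambda>_::nat. count_space (UNIV :: ('s \<times> 'a \<times> 'b) set)))"
proof -
  interpret IT: Ionescu_Tulcea "kernel s \<pi> \<phi>" "\<lambda>_. count_space UNIV"
    by (rule Ionescu_Tulcea_kernel)
  show ?thesis
    unfolding law_def by (rule IT.PF.sets_lim)
qed

lemma measurable_stage_law: "(\<lambda>\<omega>. \<omega> t) \<in> law s \<pi> \<phi> \<rightarrow>\<^sub>M count_space UNIV"
  by (subst measurable_cong_sets[OF sets_law refl]) simp

text \<open>Outcomes are appended one at a time. Lists and outcomes range over countable types, so
  the product of the two discrete sigma-algebras is again discrete and appending is
  measurable.\<close>

lemma measurable_map_law: "(\<lambda>\<omega>. map \<omega> [0..<t]) \<in> law s \<pi> \<phi> \<rightarrow>\<^sub>M count_space UNIV"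
proof (induction t)
  case (Suc t)
  have "(\<lambda>\<omega>. (\<lambda>(ks, k). ks @ [k]) (map \<omega> [0..<t], \<omega> t)) \<in> law s \<pi> \<phi> \<rightarrow>\<^sub>M count_space UNIV"
    by (rule measurable_compose[OF measurable_Pair[OF Suc.IH measurable_stage_law]])
      (simp add: pair_measure_countable)
  then show ?case
    by simp
qed simp

text \<open>The law of \<open>(S_t, A_t, B_t)\<close> as a \<open>pmf\<close>, so that expectations
  become finite sums. The index is \<open>Suc t\<close> because
  \<open>marginal s \<pi> \<phi> t\<close> lists only the stages before \<open>t\<close>.\<close>

definition outcome ::
  "'s \<Rightarrow> ('s, 'a, 'b, 'a) strategy \<Rightarrow> ('s, 'a, 'b, 'b) strategy \<Rightarrow> nat \<Rightarrow> ('s \<times> 'a \<times> 'b) pmf" where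
  "outcome s \<pi> \<phi> t = map_pmf last (marginal s \<pi> \<phi> (Suc t))"

lemma distr_law_outcome:
  "distr (law s \<pi> \<phi>) (count_space UNIV) (\<lambda>\<omega>. \<omega> t) = measure_pmf (outcome s \<pi> \<phi> t)"
proof -
  have "measure_pmf (outcome s \<pi> \<phi> t) =
      distr (distr (law s \<pi> \<phi>) (count_space UNIV) (\<lambda>\<omega>. map \<omega> [0..<Suc t])) (count_space UNIV) last"
    by (simp only: outcome_def map_pmf_rep_eq distr_law)
  also have "\<dots> = distr (law s \<pi> \<phi>) (count_space UNIV) (last \<circ> (\<lambda>\<omega>. map \<omega> [0..<Suc t]))"
    by (rule distr_distr[OF _ measurable_map_law]) simp
  also have "last \<circ> (\<lambda>\<omega>. map \<omega> [0..<Suc t]) = (\<lambda>\<omega>. \<omega> t)"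
    by (auto simp: fun_eq_iff)
  finally show ?thesis ..
qed

lemma integral_law:
  fixes g :: "'s \<times> 'a \<times> 'b \<Rightarrow> real"
  shows "(\<integral>\<omega>. g (\<omega> t) \<partial>law s \<pi> \<phi>) = measure_pmf.expectation (outcome s \<pi> \<phi> t) g"
  unfolding distr_law_outcome[symmetric]
  by (rule integral_distr[OF measurable_stage_law, symmetric]) simp

lemma measure_law:
  "measure (law s \<pi> \<phi>) {\<omega> \<in> space (law s \<pi> \<phi>). Q (\<omega> t)} =
    measure_pmf.expectation (outcome s \<pi> \<phi> t) (\<lambda>k. of_bool (Q k))"
proof -
  have "measure (law s \<pi> \<phi>) {\<omega> \<in> space (law s \<pi> \<phi>). Q (\<omega> t)} =
      measure (distr (law s \<pi> \<phi>) (count_space UNIV) (\<lambda>\<omega>. \<omega> t)) {k. Q k}"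
    by (subst measure_distr[OF measurable_stage_law]) (auto intro!: arg_cong[where f="measure _"])
  also have "\<dots> = measure_pmf.expectation (outcome s \<pi> \<phi> t) (indicator {k. Q k})"
    by (simp add: distr_law_outcome)
  also have "indicator {k. Q k} = (\<lambda>k. of_bool (Q k) :: real)"
    by (auto simp: indicator_def)
  finally show ?thesis .
qed

section \<open>Finite supports and the one-step evolution of outcomes\<close>

lemma finite_K: "finite K"
proof -
  have "K = Sigma S (\<lambda>s. A s \<times> B s)"
    by (auto simp: K_def)
  then show ?thesis
    using finite_states finite_actions1 finite_actions2 by simp
qed

lemma finite_transitions: "(s, a, b) \<in> K \<Longrightarrow> finite (set_pmf (P s a b))"
  using transitions finite_states by (simp add: K_def) (meson finite_subset)

text \<open>The stage outcomes that have positive probability at some history, reachable or not.\<close>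

definition compatible ::
  "('s, 'a, 'b, 'a) strategy \<Rightarrow> ('s, 'a, 'b, 'b) strategy \<Rightarrow> ('s \<times> 'a \<times> 'b) set" where
  "compatible \<pi> \<phi> = {(s, a, b). \<exists>h. (h, s) \<in> histories \<and> a \<in> set_pmf (\<pi> (h, s)) \<and> b \<in> set_pmf (\<phi> (h, s))}"

context
  fixes \<pi> :: "('s, 'a, 'b, 'a) strategy" and \<phi> :: "('s, 'a, 'b, 'b) strategy" and s :: 's
  assumes strategies: "\<pi> \<in> strategies1" "\<phi> \<in> strategies2" and init: "s \<in> S"
begin

lemma compatible_subset_K: "compatible \<pi> \<phi> \<subseteq> K"
  using strategies by (fastforce simp: compatible_def K_def strategies1_def strategies2_def histories_def)

text \<open>The last triple of \<open>ks\<close> lies in \<open>K\<close>, so the next state lies in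
  \<open>S\<close>. Together with \<open>ks\<close> it forms the history that
  \<open>compatible\<close> asks for, whether or not \<open>ks\<close> has positive
  probability.\<close>

lemma set_stage:
  assumes "ks \<in> lists K"
  shows "set_pmf (stage s \<pi> \<phi> ks) \<subseteq> compatible \<pi> \<phi>"
proof -
  have "set_pmf (if ks = [] then return_pmf s else (case last ks of (s', a, b) \<Rightarrow> P s' a b)) \<subseteq> S"
  proof (cases "ks = []")
    case False
    then have "last ks \<in> K"
      using assms last_in_set by blast
    then show ?thesis
      using False transitions by (force simp: K_def)
  qed (use init in simp)
  then show ?thesis
    using assms by (fastforce simp: stage_def compatible_def histories_def simp del: in_lists_conv_set)
qed

lemma set_marginal: "ks \<in> set_pmf (marginal s \<pi> \<phi> t) \<Longrightarrow> ks \<in> lists K"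
proof (induction t arbitrary: ks)
  case (Suc t)
  then show ?case
    using set_stage compatible_subset_K by fastforce
qed simp

lemma set_outcome: "set_pmf (outcome s \<pi> \<phi> t) \<subseteq> compatible \<pi> \<phi>"
  using set_stage set_marginal[of _ t] by (auto simp: outcome_def image_image) blast

lemma finite_outcome: "finite (set_pmf (outcome s \<pi> \<phi> t))"
  using set_outcome compatible_subset_K finite_K by (meson finite_subset)

lemma outcome_0: "map_pmf fst (outcome s \<pi> \<phi> 0) = return_pmf s"
  by (simp add: outcome_def stage_def map_bind_pmf bind_return_pmf pmf.map_comp o_def)

lemma map_fst_stage:
  "map_pmf fst (stage s \<pi> \<phi> ks) = (if ks = [] then return_pmf s else (case last ks of (s', a, b) \<Rightarrow> P s' a b))"
  by (simp add: stage_def map_bind_pmf bind_return_pmf')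

lemma marginal_nonempty: "ks \<in> set_pmf (marginal s \<pi> \<phi> (Suc t)) \<Longrightarrow> ks \<noteq> []"
  by auto

text \<open>The actions of the new stage integrate out, which leaves the transition from the last
  triple. The list is nonempty, so the branch of \<open>stage\<close> for the initial state never
  occurs.\<close>

lemma outcome_Suc:
  "map_pmf fst (outcome s \<pi> \<phi> (Suc t)) = bind_pmf (outcome s \<pi> \<phi> t) (\<lambda>(s', a, b). P s' a b)"
proof -
  have "map_pmf fst (outcome s \<pi> \<phi> (Suc t)) =
      bind_pmf (marginal s \<pi> \<phi> (Suc t)) (\<lambda>ks. map_pmf fst (stage s \<pi> \<phi> ks))"
    unfolding outcome_def marginal.simps(2)[of _ _ _ "Suc t"]
    by (simp add: map_bind_pmf pmf.map_comp o_def del: marginal.simps)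
  also have "\<dots> = bind_pmf (marginal s \<pi> \<phi> (Suc t)) (\<lambda>ks. case last ks of (s', a, b) \<Rightarrow> P s' a b)"
    by (intro bind_pmf_cong refl) (simp add: map_fst_stage marginal_nonempty del: marginal.simps)
  finally show ?thesis
    by (simp add: outcome_def bind_map_pmf del: marginal.simps)
qed

lemma expectation_outcome_Suc:
  fixes x :: "'s \<Rightarrow> real"
  shows "measure_pmf.expectation (outcome s \<pi> \<phi> (Suc t)) (\<lambda>k. x (fst k)) =
    measure_pmf.expectation (outcome s \<pi> \<phi> t) (\<lambda>(s', a, b). measure_pmf.expectation (P s' a b) x)"
proof -
  have fin: "finite (set_pmf (case k of (s', a, b) \<Rightarrow> P s' a b))" if "k \<in> set_pmf (outcome s \<pi> \<phi> t)" for k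
  proof -
    have "k \<in> K"
      using that set_outcome compatible_subset_K by blast
    then show ?thesis
      using finite_transitions by (cases k) auto
  qed
  have "measure_pmf.expectation (outcome s \<pi> \<phi> (Suc t)) (\<lambda>k. x (fst k)) =
      measure_pmf.expectation (map_pmf fst (outcome s \<pi> \<phi> (Suc t))) x"
    by simp
  also have "\<dots> = (\<Sum>k\<in>set_pmf (outcome s \<pi> \<phi> t).
      pmf (outcome s \<pi> \<phi> t) k *\<^sub>R measure_pmf.expectation (case k of (s', a, b) \<Rightarrow> P s' a b) x)"
    unfolding outcome_Suc by (rule pmf_expectation_bind[OF finite_outcome fin]) auto
  also have "\<dots> = measure_pmf.expectation (outcome s \<pi> \<phi> t)
      (\<lambda>k. measure_pmf.expectation (case k of (s', a, b) \<Rightarrow> P s' a b) x)"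
    by (rule integral_measure_pmf[symmetric, OF finite_outcome]) auto
  finally show ?thesis
    by (simp add: case_prod_unfold)
qed

text \<open>The supermartingale inequality in telescoped form: each stage trades
  \<open>x(S_n)\<close> for the gain \<open>g\<close> and \<open>x(S_(n+1))\<close>. It is applied
  with the payoff, with its negative, and with the indicator of the states other than the final
  one.\<close>

lemma drift_sum_le:
  fixes x :: "'s \<Rightarrow> real" and g :: "'s \<Rightarrow> 'a \<Rightarrow> 'b \<Rightarrow> real"
  assumes drift: "\<And>s' a b. (s', a, b) \<in> compatible \<pi> \<phi> \<Longrightarrow> g s' a b + measure_pmf.expectation (P s' a b) x \<le> x s'"
  shows "(\<Sum>t<n. measure_pmf.expectation (outcome s \<pi> \<phi> t) (\<lambda>(s', a, b). g s' a b))
    + measure_pmf.expectation (outcome s \<pi> \<phi> n) (\<lambda>k. x (fst k)) \<le> x s"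
proof (induction n)
  case 0
  have "measure_pmf.expectation (outcome s \<pi> \<phi> 0) (\<lambda>k. x (fst k)) =
      measure_pmf.expectation (map_pmf fst (outcome s \<pi> \<phi> 0)) x"
    by simp
  then show ?case
    by (simp add: outcome_0)
next
  case (Suc n)
  let ?E = "measure_pmf.expectation (outcome s \<pi> \<phi> n)"
  have int: "integrable (outcome s \<pi> \<phi> n) (h :: _ \<Rightarrow> real)" for h
    by (rule integrable_measure_pmf_finite[OF finite_outcome])
  have "?E (\<lambda>(s', a, b). g s' a b) + ?E (\<lambda>(s', a, b). measure_pmf.expectation (P s' a b) x) =
      ?E (\<lambda>(s', a, b). g s' a b + measure_pmf.expectation (P s' a b) x)"
    by (subst Bochner_Integration.integral_add[OF int int, symmetric]) (simp add: case_prod_unfold)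
  also have "\<dots> \<le> ?E (\<lambda>k. x (fst k))"
    using set_outcome[of n] drift by (intro integral_mono_AE int) (fastforce simp: AE_measure_pmf_iff)
  finally show ?case
    using Suc.IH by (simp add: expectation_outcome_Suc)
qed

section \<open>Passing to the limit under transience\<close>

lemma expectation_vanishing_le:
  assumes zero: "\<And>a b. a \<in> A f \<Longrightarrow> b \<in> B f \<Longrightarrow> h f a b = 0"
  obtains C where "\<And>t. \<bar>measure_pmf.expectation (outcome s \<pi> \<phi> t) (\<lambda>(s', a, b). h s' a b)\<bar>
    \<le> C * measure (law s \<pi> \<phi>) {\<omega> \<in> space (law s \<pi> \<phi>). fst (\<omega> t) \<noteq> f}"
proof
  fix t
  let ?E = "measure_pmf.expectation (outcome s \<pi> \<phi> t)"
  \<comment> \<open>A bound for \<open>h\<close> on all of \<open>K\<close>, hence the same for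
    every \<open>t\<close>. Where the state is \<open>f\<close>, \<open>h\<close> vanishes, so
    \<open>h\<close> is dominated by \<open>?C\<close> times the indicator of the other
    states.\<close>
  let ?C = "\<Sum>(s', a, b)\<in>K. \<bar>h s' a b\<bar>"
  have int: "integrable (outcome s \<pi> \<phi> t) (g :: _ \<Rightarrow> real)" for g
    by (rule integrable_measure_pmf_finite[OF finite_outcome])
  have C: "\<bar>h s' a b\<bar> \<le> ?C" if "(s', a, b) \<in> K" for s' a b
    using member_le_sum[OF that, of "\<lambda>(s', a, b). \<bar>h s' a b\<bar>"] finite_K by auto
  have "\<bar>?E (\<lambda>(s', a, b). h s' a b)\<bar> \<le> ?E (\<lambda>k. \<bar>case k of (s', a, b) \<Rightarrow> h s' a b\<bar>)"
    by (rule integral_abs_bound)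
  also have "\<dots> \<le> ?E (\<lambda>k. ?C * of_bool (fst k \<noteq> f))"
  proof (intro integral_mono_AE int, unfold AE_measure_pmf_iff, intro ballI)
    fix k assume "k \<in> set_pmf (outcome s \<pi> \<phi> t)"
    then have "k \<in> K"
      using set_outcome compatible_subset_K by blast
    then show "\<bar>case k of (s', a, b) \<Rightarrow> h s' a b\<bar> \<le> ?C * of_bool (fst k \<noteq> f)"
      using C zero by (cases k) (auto simp: K_def)
  qed
  finally show "\<bar>?E (\<lambda>(s', a, b). h s' a b)\<bar>
      \<le> ?C * measure (law s \<pi> \<phi>) {\<omega> \<in> space (law s \<pi> \<phi>). fst (\<omega> t) \<noteq> f}"
    using measure_law[of s \<pi> \<phi> "\<lambda>k. fst k \<noteq> f" t] by simp
qed

lemma summable_payoffs: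
  assumes "transient f"
  shows "summable (\<lambda>t. measure_pmf.expectation (outcome s \<pi> \<phi> t) (\<lambda>(s', a, b). r s' a b))"
proof -
  obtain C where C: "\<And>t. \<bar>measure_pmf.expectation (outcome s \<pi> \<phi> t) (\<lambda>(s', a, b). r s' a b)\<bar>
      \<le> C * measure (law s \<pi> \<phi>) {\<omega> \<in> space (law s \<pi> \<phi>). fst (\<omega> t) \<noteq> f}"
    using assms expectation_vanishing_le[of f r] by (auto simp: transient_def)
  show ?thesis
  proof (rule summable_comparison_test[OF _ summable_mult])
    show "summable (\<lambda>t. measure (law s \<pi> \<phi>) {\<omega> \<in> space (law s \<pi> \<phi>). fst (\<omega> t) \<noteq> f})"
      using assms strategies init by (simp add: transient_def)
  qed (use C in auto)
qed

lemma expectation_state_tendsto_0: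
  fixes x :: "'s \<Rightarrow> real"
  assumes "transient f" and "x f = 0"
  shows "(\<lambda>t. measure_pmf.expectation (outcome s \<pi> \<phi> t) (\<lambda>k. x (fst k))) \<longlonglongrightarrow> 0"
proof -
  obtain C where C: "\<And>t. \<bar>measure_pmf.expectation (outcome s \<pi> \<phi> t) (\<lambda>(s', a, b). x s')\<bar>
      \<le> C * measure (law s \<pi> \<phi>) {\<omega> \<in> space (law s \<pi> \<phi>). fst (\<omega> t) \<noteq> f}"
    using assms(2) expectation_vanishing_le[of f "\<lambda>s' a b. x s'"] by auto
  have "summable (\<lambda>t. measure (law s \<pi> \<phi>) {\<omega> \<in> space (law s \<pi> \<phi>). fst (\<omega> t) \<noteq> f})"
    using assms(1) strategies init by (simp add: transient_def)
  then have "(\<lambda>t. C * measure (law s \<pi> \<phi>) {\<omega> \<in> space (law s \<pi> \<phi>). fst (\<omega> t) \<noteq> f}) \<longlonglongrightarrow> 0"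
    by (intro tendsto_mult_right_zero summable_LIMSEQ_zero)
  then show ?thesis
    by (rule Lim_null_comparison[rotated]) (use C in \<open>auto simp: case_prod_unfold\<close>)
qed

lemma V_eq_suminf:
  "V \<pi> \<phi> s = (\<Sum>t. measure_pmf.expectation (outcome s \<pi> \<phi> t) (\<lambda>(s', a, b). r s' a b))"
  unfolding V_def by (intro suminf_cong integral_law)

text \<open>As \<open>n\<close> grows, the sums in \<open>drift_sum_le\<close> tend to the payoff
  series and the remainder \<open>E x(S_n)\<close> tends to 0, being the expectation of a function
  that vanishes at \<open>f\<close>.\<close>

lemma V_le:
  fixes x :: "'s \<Rightarrow> real"
  assumes "transient f" and "x f = 0"
    and drift: "\<And>s' a b. (s', a, b) \<in> compatible \<pi> \<phi> \<Longrightarrow> r s' a b + measure_pmf.expectation (P s' a b) x \<le> x s'"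
  shows "V \<pi> \<phi> s \<le> x s"
proof -
  let ?E = "\<lambda>t. measure_pmf.expectation (outcome s \<pi> \<phi> t)"
  have "(\<lambda>n. (\<Sum>t<n. ?E t (\<lambda>(s', a, b). r s' a b)) + ?E n (\<lambda>k. x (fst k))) \<longlonglongrightarrow> V \<pi> \<phi> s + 0"
    unfolding V_eq_suminf
    by (intro tendsto_add summable_LIMSEQ summable_payoffs[OF assms(1)]
      expectation_state_tendsto_0[where f=f and x=x, OF assms(1,2)])
  then show ?thesis
    using drift_sum_le[of r x, OF drift] by (intro LIMSEQ_le_const2) auto
qed

lemma V_ge:
  fixes x :: "'s \<Rightarrow> real"
  assumes "transient f" and "x f = 0"
    and drift: "\<And>s' a b. (s', a, b) \<in> compatible \<pi> \<phi> \<Longrightarrow> r s' a b + measure_pmf.expectation (P s' a b) x \<ge> x s'"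
  shows "V \<pi> \<phi> s \<ge> x s"
proof -
  let ?E = "\<lambda>t. measure_pmf.expectation (outcome s \<pi> \<phi> t)"
  have "(\<lambda>n. (\<Sum>t<n. ?E t (\<lambda>(s', a, b). r s' a b)) + ?E n (\<lambda>k. x (fst k))) \<longlonglongrightarrow> V \<pi> \<phi> s + 0"
    unfolding V_eq_suminf
    by (intro tendsto_add summable_LIMSEQ summable_payoffs[OF assms(1)]
      expectation_state_tendsto_0[where f=f and x=x, OF assms(1,2)])
  \<comment> \<open>The lower bound is the upper bound for \<open>- r\<close> and
    \<open>- x\<close>.\<close>
  moreover have "x s \<le> (\<Sum>t<n. ?E t (\<lambda>(s', a, b). r s' a b)) + ?E n (\<lambda>k. x (fst k))" for n
    using drift_sum_le[of "\<lambda>s' a b. - r s' a b" "\<lambda>s'. - x s'" n] drift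
    by (fastforce simp: case_prod_unfold sum_negf)
  ultimately show ?thesis
    by (intro LIMSEQ_le_const) auto
qed

end

text \<open>\<open>W s\<close> bounds the expected number of stages spent outside \<open>f\<close>:
  the remainder \<open>E W(S_n)\<close> is nonnegative, so every partial sum of the probabilities
  stays below \<open>W s\<close>.\<close>

lemma transientI_Lyapunov:
  fixes W :: "'s \<Rightarrow> real"
  assumes "f \<in> S" and "\<And>a b. a \<in> A f \<Longrightarrow> b \<in> B f \<Longrightarrow> r f a b = 0 \<and> pmf (P f a b) f = 1"
    and nonneg: "\<And>s. s \<in> S \<Longrightarrow> 0 \<le> W s"
    and drift: "\<And>s a b. (s, a, b) \<in> K \<Longrightarrow> of_bool (s \<noteq> f) + measure_pmf.expectation (P s a b) W \<le> W s"
  shows "transient f"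
  unfolding transient_def
proof (intro conjI ballI)
  fix \<pi> \<phi> s assume st: "\<pi> \<in> strategies1" "\<phi> \<in> strategies2" "s \<in> S"
  let ?E = "\<lambda>t. measure_pmf.expectation (outcome s \<pi> \<phi> t)"
  have "(\<Sum>t<n. ?E t (\<lambda>(s', a, b). of_bool (s' \<noteq> f))) \<le> W s" for n
  proof -
    have "0 \<le> W (fst k)" if "k \<in> set_pmf (outcome s \<pi> \<phi> n)" for k
    proof (rule nonneg)
      have "k \<in> K"
        using that set_outcome[OF st] compatible_subset_K[OF st] by blast
      then show "fst k \<in> S"
        by (auto simp: K_def)
    qed
    then have "0 \<le> ?E n (\<lambda>k. W (fst k))"
      by (intro integral_nonneg_AE) (simp add: AE_measure_pmf_iff)
    moreover have "(\<Sum>t<n. ?E t (\<lambda>(s', a, b). of_bool (s' \<noteq> f))) + ?E n (\<lambda>k. W (fst k)) \<le> W s"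
      by (rule drift_sum_le[OF st]) (use drift compatible_subset_K[OF st] in blast)
    ultimately show ?thesis
      by linarith
  qed
  then have "(\<Sum>t<n. measure (law s \<pi> \<phi>) {\<omega> \<in> space (law s \<pi> \<phi>). fst (\<omega> t) \<noteq> f}) \<le> W s" for n
    by (simp add: measure_law[of s \<pi> \<phi> "\<lambda>k. fst k \<noteq> f"] case_prod_unfold)
  then show "summable (\<lambda>t. measure (law s \<pi> \<phi>) {\<omega> \<in> space (law s \<pi> \<phi>). fst (\<omega> t) \<noteq> f})"
    by (intro summableI_nonneg_bounded) auto
qed (use assms in auto)

text \<open>Here \<open>p\<close> guarantees at least \<open>v\<close> and \<open>q\<close> at most
  \<open>v\<close>, so the outer supremum and infimum are attained at \<open>p\<close> and
  \<open>q\<close>. The bounds \<open>l\<close> and \<open>u\<close> keep the inner ones within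
  bounded sets, where \<open>INF\<close> and \<open>SUP\<close> on the reals behave as
  intended.\<close>

lemma saddle_point:
  assumes bounds: "\<And>\<pi> \<phi>. \<pi> \<in> strategies1 \<Longrightarrow> \<phi> \<in> strategies2 \<Longrightarrow> V \<pi> \<phi> s \<in> {l..u}"
    and p: "p \<in> strategies1" "\<And>\<phi>. \<phi> \<in> strategies2 \<Longrightarrow> v \<le> V p \<phi> s"
    and q: "q \<in> strategies2" "\<And>\<pi>. \<pi> \<in> strategies1 \<Longrightarrow> V \<pi> q s \<le> v"
  shows "lower_value s = v" "upper_value s = v"
    "(INF \<phi>\<in>strategies2. V p \<phi> s) = v" "(SUP \<pi>\<in>strategies1. V \<pi> q s) = v"
proof -
  have below: "bdd_below ((\<lambda>\<phi>. V \<pi> \<phi> s) ` strategies2)" if "\<pi> \<in> strategies1" for \<pi>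
    using bounds that by (intro bdd_belowI2[of _ l]) auto
  have above: "bdd_above ((\<lambda>\<pi>. V \<pi> \<phi> s) ` strategies1)" if "\<phi> \<in> strategies2" for \<phi>
    using bounds that by (intro bdd_aboveI2[of _ _ u]) auto
  have inf: "(INF \<phi>\<in>strategies2. V \<pi> \<phi> s) \<le> v" if "\<pi> \<in> strategies1" for \<pi>
    using cINF_lower[OF below[OF that] q(1)] q(2)[OF that] by linarith
  have sup: "v \<le> (SUP \<pi>\<in>strategies1. V \<pi> \<phi> s)" if "\<phi> \<in> strategies2" for \<phi>
    using cSUP_upper[OF p(1) above[OF that]] p(2)[OF that] by linarith
  show inf_p: "(INF \<phi>\<in>strategies2. V p \<phi> s) = v"
    using p q(1) inf by (intro antisym cINF_greatest) auto
  show sup_q: "(SUP \<pi>\<in>strategies1. V \<pi> q s) = v"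
    using q p(1) sup by (intro antisym cSUP_least) auto
  show "lower_value s = v"
    unfolding lower_value_def
    by (rule cSup_eq_maximum) (use inf_p p(1) inf in auto)
  show "upper_value s = v"
    unfolding upper_value_def
    by (rule cInf_eq_minimum) (use sup_q q(1) sup in auto)
qed

end

section \<open>Transience of the dice game\<close>

text \<open>
  Every transition other than rolling an ace strictly increases \<open>progress\<close>; the summand for \<open>\<tau> = 0\<close>
  makes this true of stopping, which moves the turn score to the account. As an ace has probability
  \<open>1/6\<close>, the expectation of \<open>2 ^ progress\<close> grows at least by the factor \<open>5/6 * 2 > 1\<close>. Any value at the
  final state that exceeds all others would do.
\<close>

fun progress :: "dice_state \<Rightarrow> nat" where
  "progress Start = 0"
| "progress Final = 1000"
| "progress (Turn1 \<alpha> \<beta> \<tau>) = 2 * (\<alpha> + \<beta> + \<tau>) + of_bool (\<tau> = 0)"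
| "progress (Turn2 \<alpha> \<beta> \<tau>) = 2 * (\<alpha> + \<beta> + \<tau>) + of_bool (\<tau> = 0)"

section \<open>Expectations under the dice transitions\<close>

lemma sum_2_6: "(\<Sum>k=2..6::nat. f k) = f 2 + f 3 + f 4 + f 5 + f 6" for f :: "nat \<Rightarrow> real"
proof -
  have "{2..6::nat} = {2, 3, 4, 5, 6}"
    by auto
  then show ?thesis
    by simp
qed

text \<open>Splitting off the ace gives the shape of \<open>roll1\<close> and
  \<open>roll2\<close>.\<close>

lemma expectation_die:
  fixes f :: "nat \<Rightarrow> real"
  shows "measure_pmf.expectation (pmf_of_set {1..6}) f = 1/6 * f 1 + 1/6 * (\<Sum>k=2..6. f k)"
proof -
  have "{1..6::nat} = insert 1 {2..6}"
    by auto
  then show ?thesis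
    by (subst integral_pmf_of_set) (auto simp: add_divide_distrib)
qed

lemma expectation_trans_Start:
  "measure_pmf.expectation (dice_trans Start a b) x = 1/2 * x (Turn1 0 0 0) + 1/2 * x (Turn2 0 0 0)"
  for x :: "dice_state \<Rightarrow> real"
  by (simp add: integral_pmf_of_set)

lemma expectation_trans_Turn1:
  "measure_pmf.expectation (dice_trans (Turn1 \<alpha> \<beta> \<tau>) a b) x =
    (if \<alpha> + \<tau> \<ge> 200 then x Final else if a = Roll then roll1 x \<alpha> \<beta> \<tau> else stop1 x \<alpha> \<beta> \<tau>)"
  for x :: "dice_state \<Rightarrow> real"
  by (simp add: roll1_def stop1_def expectation_die sum_2_6 if_distrib[of x] del: One_nat_def)

lemma expectation_trans_Turn2:
  "measure_pmf.expectation (dice_trans (Turn2 \<alpha> \<beta> \<tau>) a b) x =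
    (if \<beta> + \<tau> \<ge> 200 then x Final else if b = Roll then roll2 x \<alpha> \<beta> \<tau> else stop2 x \<alpha> \<beta> \<tau>)"
  for x :: "dice_state \<Rightarrow> real"
  by (simp add: roll2_def stop2_def expectation_die sum_2_6 if_distrib[of x] del: One_nat_def)

lemmas expectation_trans = expectation_trans_Start expectation_trans_Turn1 expectation_trans_Turn2

lemma progress_le:
  assumes "s \<in> dice_states"
  shows "progress s \<le> 1000" and "s \<noteq> Final \<Longrightarrow> progress s < 1000"
  using assms by (cases s; auto simp: dice_states_def of_bool_def)+

lemma two_power_less: "2 * 2 ^ m \<le> (2 :: real) ^ n" if "m < n"
proof -
  have "(2 :: real) ^ Suc m \<le> 2 ^ n"
    using that by (intro power_increasing) auto
  then show ?thesis
    by simp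
qed

text \<open>A roll is the critical case. Five faces at least double \<open>?G\<close> and the ace
  still contributes at least \<open>1/6\<close>, so the expectation is at least
  \<open>5/3 * ?G s + 1/6\<close>; as \<open>?G s\<close> is at least 1, this leaves a gain of at
  least \<open>1/2\<close>. All other transitions double \<open>?G\<close>.\<close>

lemma progress_drift:
  assumes "(s, a, b) \<in> dice.K" and "s \<noteq> Final"
  shows "measure_pmf.expectation (dice_trans s a b) (\<lambda>s. 2 ^ progress s) \<ge> (2 ^ progress s + 1 / 2 :: real)"
proof -
  let ?G = "\<lambda>s. (2 :: real) ^ progress s"
  have one: "1 \<le> ?G t" for t
    by simp
  have up: "2 * ?G t \<le> ?G t'" if "progress t < progress t'" for t t'
    using that by (rule two_power_less)
  have final: "2 * ?G s \<le> ?G Final"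
    using assms progress_le[of s] by (intro up) (simp add: dice.K_def)
  show ?thesis
  proof (cases s)
    case Start
    have "2 * ?G Start \<le> ?G (Turn1 0 0 0)" "2 * ?G Start \<le> ?G (Turn2 0 0 0)"
      by (intro up; simp)+
    then show ?thesis
      unfolding Start expectation_trans by simp
  next
    case Final
    then show ?thesis
      using assms by simp
  next
    case (Turn1 \<alpha> \<beta> \<tau>)
    have roll: "2 * ?G s \<le> ?G (Turn1 \<alpha> \<beta> (\<tau> + k))" if "k \<ge> 2" for k
      using that unfolding Turn1 by (intro up) auto
    \<comment> \<open>Admissibility forces \<open>\<tau> > 0\<close> here, since an empty turn score
      allows only \<open>Roll\<close>.\<close>
    have stop: "2 * ?G s \<le> ?G (Turn2 (\<alpha> + \<tau>) \<beta> 0)" if "a \<noteq> Roll"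
      using that assms unfolding Turn1
      by (intro up) (auto simp: dice.K_def holder_actions_def split: if_splits)
    have "10 * ?G s \<le> (\<Sum>k=2..6. ?G (Turn1 \<alpha> \<beta> (\<tau> + k)))"
      using sum_mono[of "{2..6}" "\<lambda>_. 2 * ?G s" "\<lambda>k. ?G (Turn1 \<alpha> \<beta> (\<tau> + k))"] roll
      by (simp del: progress.simps)
    then have "?G s + 1 / 2 \<le> roll1 ?G \<alpha> \<beta> \<tau>"
      using one[of s] one[of "Turn2 \<alpha> \<beta> 0"] unfolding roll1_def by linarith
    then show ?thesis
      using final stop one[of s] unfolding Turn1 expectation_trans stop1_def by argo
  next
    case (Turn2 \<alpha> \<beta> \<tau>)
    have roll: "2 * ?G s \<le> ?G (Turn2 \<alpha> \<beta> (\<tau> + k))" if "k \<ge> 2" for k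
      using that unfolding Turn2 by (intro up) auto
    have stop: "2 * ?G s \<le> ?G (Turn1 \<alpha> (\<beta> + \<tau>) 0)" if "b \<noteq> Roll"
      using that assms unfolding Turn2
      by (intro up) (auto simp: dice.K_def holder_actions_def split: if_splits)
    have "10 * ?G s \<le> (\<Sum>k=2..6. ?G (Turn2 \<alpha> \<beta> (\<tau> + k)))"
      using sum_mono[of "{2..6}" "\<lambda>_. 2 * ?G s" "\<lambda>k. ?G (Turn2 \<alpha> \<beta> (\<tau> + k))"] roll
      by (simp del: progress.simps)
    then have "?G s + 1 / 2 \<le> roll2 ?G \<alpha> \<beta> \<tau>"
      using one[of s] one[of "Turn1 \<alpha> \<beta> 0"] unfolding roll2_def by linarith
    then show ?thesis
      using final stop one[of s] unfolding Turn2 expectation_trans stop2_def by argo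
  qed
qed

lemma transient_dice: "dice.transient Final"
proof (rule dice.transientI_Lyapunov)
  \<comment> \<open>Subtracting from the largest value turns growth into decrease and keeps
    \<open>?W\<close> nonnegative on the states; the factor 2 turns the gain of \<open>1/2\<close>
    into a drop of at least 1.\<close>
  let ?W = "\<lambda>s. 2 * (2 ^ progress Final - 2 ^ progress s) :: real"
  show "Final \<in> dice_states"
    by (simp add: dice_states_def)
  show "0 \<le> ?W s" if "s \<in> dice_states" for s
    using progress_le(1)[OF that] power_increasing[of "progress s" "progress Final" "2 :: real"] by simp
  show "of_bool (s \<noteq> Final) + measure_pmf.expectation (dice_trans s a b) ?W \<le> ?W s"
    if k: "(s, a, b) \<in> dice.K" for s a b
  proof -
    have int: "integrable (dice_trans s a b) (h :: dice_state \<Rightarrow> real)" for h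
      by (rule integrable_measure_pmf_finite[OF dice.finite_transitions[OF k]])
    have "measure_pmf.expectation (dice_trans s a b) ?W =
        2 * (2 ^ progress Final - measure_pmf.expectation (dice_trans s a b) (\<lambda>s. 2 ^ progress s))"
      by (simp add: Bochner_Integration.integral_diff[OF int int] del: progress.simps)
    then show ?thesis
      using progress_drift[OF k] by (cases "s = Final") (auto simp del: progress.simps(2))
  qed
qed auto

section \<open>Fixed points of the optimality operator\<close>

lemma U_mono:
  assumes "\<And>s. x s \<le> y s"
  shows "U x s \<le> U y s"
proof -
  have le: "roll1 x \<alpha> \<beta> \<tau> \<le> roll1 y \<alpha> \<beta> \<tau>" "roll2 x \<alpha> \<beta> \<tau> \<le> roll2 y \<alpha> \<beta> \<tau>"
    "stop1 x \<alpha> \<beta> \<tau> \<le> stop1 y \<alpha> \<beta> \<tau>" "stop2 x \<alpha> \<beta> \<tau> \<le> stop2 y \<alpha> \<beta> \<tau>" for \<alpha> \<beta> \<tau>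
    unfolding roll1_def roll2_def stop1_def stop2_def
    by (intro add_mono mult_left_mono sum_mono assms; simp)+
  show ?thesis
    using assms le
    by (cases s) (auto intro!: add_mono max.mono min.mono simp del: max.bounded_iff min.bounded_iff)
qed

text \<open>The constants 0 and 1 are a sub- and a supersolution: the first starts an increasing
  iteration, the second caps it.\<close>

lemma U_bounds: "0 \<le> U (\<lambda>_. 0) s" "U (\<lambda>_. 1) s \<le> 1"
  by (cases s; simp add: roll1_def roll2_def stop1_def stop2_def)+

lemma tendsto_U:
  assumes "\<And>s. (\<lambda>n. X n s) \<longlonglongrightarrow> x s"
  shows "(\<lambda>n. U (X n) s) \<longlonglongrightarrow> U x s"
proof -
  have lim: "(\<lambda>n. roll1 (X n) \<alpha> \<beta> \<tau>) \<longlonglongrightarrow> roll1 x \<alpha> \<beta> \<tau>" "(\<lambda>n. roll2 (X n) \<alpha> \<beta> \<tau>) \<longlonglongrightarrow> roll2 x \<alpha> \<beta> \<tau>"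
    "(\<lambda>n. stop1 (X n) \<alpha> \<beta> \<tau>) \<longlonglongrightarrow> stop1 x \<alpha> \<beta> \<tau>" "(\<lambda>n. stop2 (X n) \<alpha> \<beta> \<tau>) \<longlonglongrightarrow> stop2 x \<alpha> \<beta> \<tau>" for \<alpha> \<beta> \<tau>
    unfolding roll1_def roll2_def stop1_def stop2_def
    by (intro tendsto_intros assms)+
  show ?thesis
  proof (cases s)
    case Start
    show ?thesis
      unfolding Start U.simps by (intro tendsto_intros assms)
  qed (auto intro!: tendsto_max tendsto_min lim)
qed

text \<open>Monotone bounded iteration gives a pointwise limit, and continuity of \<open>U\<close>
  makes it a fixed point. Only existence is obtained here; uniqueness follows from the saddle
  point.\<close>

lemma U_fixed_point_exists:
  obtains x where "\<And>s. x s = U x s"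
proof -
  define X where "X n = (U ^^ n) (\<lambda>_. 0)" for n
  have step: "X n s \<le> X (Suc n) s" for n s
  proof (induction n arbitrary: s)
    case 0
    show ?case
      by (simp add: X_def U_bounds(1))
  next
    case (Suc n)
    then show ?case
      using U_mono[of "X n" "X (Suc n)"] by (simp add: X_def)
  qed
  have bound: "X n s \<le> 1" for n s
  proof (induction n arbitrary: s)
    case (Suc n)
    then show ?case
      using U_mono[of "X n" "\<lambda>_. 1" s] U_bounds(2)[of s] by (simp add: X_def)
  qed (simp add: X_def)
  have "\<exists>l. (\<lambda>n. X n s) \<longlonglongrightarrow> l" for s
    using incseq_convergent[of "\<lambda>n. X n s" 1] step bound by (metis incseq_SucI)
  then obtain x where x: "\<And>s. (\<lambda>n. X n s) \<longlonglongrightarrow> x s"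
    by metis
  have "x s = U x s" for s
    using LIMSEQ_unique[OF LIMSEQ_Suc[OF x[of s]]] tendsto_U[of X x s, OF x] by (simp add: X_def)
  then show ?thesis
    by (rule that)
qed

section \<open>Value and optimal strategies\<close>

lemma compatibleE:
  assumes "(s, a, b) \<in> dice.compatible \<pi> \<phi>" and "\<pi> \<in> dice.strategies1" and "\<phi> \<in> dice.strategies2"
  obtains h where "(h, s) \<in> dice.histories" "s \<in> dice_states"
    "a \<in> set_pmf (\<pi> (h, s))" "b \<in> set_pmf (\<phi> (h, s))" "a \<in> dice_actions1 s" "b \<in> dice_actions2 s"
  using assms
  by (fastforce simp: dice.compatible_def dice.strategies1_def dice.strategies2_def dice.histories_def)

lemma V_dice_bounds:
  assumes "\<pi> \<in> dice.strategies1" and "\<phi> \<in> dice.strategies2" and "s \<in> dice_states"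
  shows "dice.V \<pi> \<phi> s \<in> {0..1}"
proof -
  \<comment> \<open>The constant 1 would fail the drift condition in a state where player one has
    reached the target: the payoff 1 is collected there and the play moves to \<open>Final\<close>,
    where the supersolution must be 0.\<close>
  let ?one = "\<lambda>s. of_bool (s \<noteq> Final) :: real"
  have "0 \<le> dice_payoff s' a b + measure_pmf.expectation (dice_trans s' a b) (\<lambda>_. 0)" for s' a b
    by (cases s') auto
  then have "0 \<le> dice.V \<pi> \<phi> s"
    by (intro dice.V_ge[OF assms transient_dice, where x="\<lambda>_. 0"]) auto
  moreover have "dice_payoff s' a b + measure_pmf.expectation (dice_trans s' a b) ?one \<le> ?one s'" for s' a b
    by (cases s') (auto simp: expectation_trans roll1_def roll2_def stop1_def stop2_def simp del: dice_trans.simps(1,3,4))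
  then have "dice.V \<pi> \<phi> s \<le> ?one s"
    by (intro dice.V_le[OF assms transient_dice]) auto
  then have "dice.V \<pi> \<phi> s \<le> 1"
    by (rule order_trans) simp
  ultimately show ?thesis
    by simp
qed

text \<open>Ties go to \<open>Roll\<close>. The tests on \<open>\<tau>\<close> also settle the
  forced moves, so that the strategy is admissible at every state.\<close>

definition greedy1 :: "(dice_state \<Rightarrow> real) \<Rightarrow> (dice_state, action, action, action) strategy" where
  "greedy1 x h = return_pmf (case snd h of
      Turn1 \<alpha> \<beta> \<tau> \<Rightarrow>
        if \<tau> = 0 \<or> \<tau> < 200 - \<alpha> \<and> stop1 x \<alpha> \<beta> \<tau> \<le> roll1 x \<alpha> \<beta> \<tau> then Roll else Stop
    | _ \<Rightarrow> Wait)"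

definition greedy2 :: "(dice_state \<Rightarrow> real) \<Rightarrow> (dice_state, action, action, action) strategy" where
  "greedy2 x h = return_pmf (case snd h of
      Turn2 \<alpha> \<beta> \<tau> \<Rightarrow>
        if \<tau> = 0 \<or> \<tau> < 200 - \<beta> \<and> roll2 x \<alpha> \<beta> \<tau> \<le> stop2 x \<alpha> \<beta> \<tau> then Roll else Stop
    | _ \<Rightarrow> Wait)"

lemma greedy_strategies: "greedy1 x \<in> dice.strategies1" "greedy2 x \<in> dice.strategies2"
  by (auto simp: dice.strategies1_def dice.strategies2_def greedy1_def greedy2_def holder_actions_def
      split: dice_state.split)

lemma greedy_pure_stationary:
  "dice.pure (greedy1 x)" "dice.stationary (greedy1 x)" "dice.pure (greedy2 x)" "dice.stationary (greedy2 x)"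
  unfolding dice.pure_def dice.stationary_def by (simp_all add: greedy1_def greedy2_def)

lemma greedy_attains: "attains_max (greedy1 x) x" "attains_min (greedy2 x) x"
  by (auto simp: attains_max_def attains_min_def greedy1_def greedy2_def Let_def)

context
  fixes x :: "dice_state \<Rightarrow> real"
  assumes fixed: "\<And>s. s \<in> dice_states \<Longrightarrow> x s = U x s"
begin

lemma fixed_Final: "x Final = 0"
  using fixed[of Final] by (simp add: dice_states_def)

text \<open>Where player one holds the die, \<open>\<pi>\<close> attains the maximum in
  \<open>U\<close>, so the drift condition holds with equality. Where player two does,
  \<open>U\<close> takes the minimum, so every action of \<open>\<phi>\<close> leaves at least
  \<open>x\<close>.\<close>

lemma V_ge_fixed_point:
  assumes "\<pi> \<in> dice.strategies1" "\<phi> \<in> dice.strategies2" "s \<in> dice_states" and max: "attains_max \<pi> x"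
  shows "x s \<le> dice.V \<pi> \<phi> s"
proof (rule dice.V_ge[where f=Final and x=x, OF assms(1-3) transient_dice fixed_Final])
  fix s' a b
  assume "(s', a, b) \<in> dice.compatible \<pi> \<phi>"
  then obtain h where h: "(h, s') \<in> dice.histories" "s' \<in> dice_states" "a \<in> set_pmf (\<pi> (h, s'))"
      "a \<in> dice_actions1 s'" "b \<in> dice_actions2 s'"
    using assms(1,2) by (elim compatibleE) auto
  show "x s' \<le> dice_payoff s' a b + measure_pmf.expectation (dice_trans s' a b) x"
  proof (cases s')
    case (Turn1 \<alpha> \<beta> \<tau>)
    \<comment> \<open>\<open>a\<close> has positive probability under \<open>\<pi>\<close> at the
      history ending in \<open>s'\<close>, and there \<open>\<pi>\<close> is a point mass on a
      maximizing action.\<close>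
    have "(a = Stop \<and> stop1 x \<alpha> \<beta> \<tau> = U x s') \<or> (a = Roll \<and> roll1 x \<alpha> \<beta> \<tau> = U x s')"
      if "0 < \<tau>" "\<alpha> + \<tau> < 200"
    proof -
      have "\<tau> < 200 - \<alpha>"
        using that by linarith
      then show ?thesis
        using max that h(1,3) unfolding Turn1 attains_max_def by (fastforce simp: Let_def)
    qed
    then show ?thesis
      using h fixed[OF h(2)] fixed_Final unfolding Turn1 expectation_trans
      by (auto simp: holder_actions_def dice_states_def split: if_splits)
  next
    case (Turn2 \<alpha> \<beta> \<tau>)
    then show ?thesis
      using h fixed[OF h(2)] fixed_Final unfolding Turn2 expectation_trans
      by (auto simp: holder_actions_def dice_states_def split: if_splits)
  next
    case Start
    then show ?thesis
      using fixed[OF h(2)] unfolding Start expectation_trans by simp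
  qed simp
qed

lemma V_le_fixed_point:
  assumes "\<pi> \<in> dice.strategies1" "\<phi> \<in> dice.strategies2" "s \<in> dice_states" and min: "attains_min \<phi> x"
  shows "dice.V \<pi> \<phi> s \<le> x s"
proof (rule dice.V_le[where f=Final and x=x, OF assms(1-3) transient_dice fixed_Final])
  fix s' a b
  assume "(s', a, b) \<in> dice.compatible \<pi> \<phi>"
  then obtain h where h: "(h, s') \<in> dice.histories" "s' \<in> dice_states" "b \<in> set_pmf (\<phi> (h, s'))"
      "a \<in> dice_actions1 s'" "b \<in> dice_actions2 s'"
    using assms(1,2) by (elim compatibleE) auto
  show "dice_payoff s' a b + measure_pmf.expectation (dice_trans s' a b) x \<le> x s'"
  proof (cases s')
    case (Turn1 \<alpha> \<beta> \<tau>)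
    then show ?thesis
      using h fixed[OF h(2)] fixed_Final unfolding Turn1 expectation_trans
      by (auto simp: holder_actions_def dice_states_def split: if_splits)
  next
    case (Turn2 \<alpha> \<beta> \<tau>)
    have "(b = Stop \<and> stop2 x \<alpha> \<beta> \<tau> = U x s') \<or> (b = Roll \<and> roll2 x \<alpha> \<beta> \<tau> = U x s')"
      if "0 < \<tau>" "\<beta> + \<tau> < 200"
    proof -
      have "\<tau> < 200 - \<beta>"
        using that by linarith
      then show ?thesis
        using min that h(1,3) unfolding Turn2 attains_min_def by (fastforce simp: Let_def)
    qed
    then show ?thesis
      using h fixed[OF h(2)] fixed_Final unfolding Turn2 expectation_trans
      by (auto simp: holder_actions_def dice_states_def split: if_splits)
  next
    case Start
    then show ?thesis
      using fixed[OF h(2)] unfolding Start expectation_trans by simp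
  qed simp
qed

text \<open>Any maximizing \<open>\<pi>\<close> may be paired with any minimizing
  \<open>\<phi>\<close>; a given strategy is later shown optimal by pairing it with a greedy
  opponent.\<close>

lemma fixed_point_saddle:
  assumes "\<pi> \<in> dice.strategies1" "attains_max \<pi> x" "\<phi> \<in> dice.strategies2" "attains_min \<phi> x" "s \<in> dice_states"
  shows "dice.lower_value s = x s" "dice.upper_value s = x s"
    "(INF \<phi>\<in>dice.strategies2. dice.V \<pi> \<phi> s) = x s" "(SUP \<pi>\<in>dice.strategies1. dice.V \<pi> \<phi> s) = x s"
  by (rule dice.saddle_point[of s 0 1 \<pi> "x s" \<phi>];
      use assms V_dice_bounds V_ge_fixed_point V_le_fixed_point in blast)+

text \<open>The left-hand sides do not mention \<open>x\<close>, so this is also the uniqueness of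
  the fixed point on the states.\<close>

lemma fixed_point_value:
  assumes "s \<in> dice_states"
  shows "dice.lower_value s = x s" "dice.upper_value s = x s"
  using fixed_point_saddle[OF greedy_strategies(1) greedy_attains(1) greedy_strategies(2) greedy_attains(2) assms]
  by auto

lemma attains_max_optimal:
  assumes "\<pi> \<in> dice.strategies1" "attains_max \<pi> x"
  shows "dice.optimal1 \<pi>"
  using assms fixed_point_saddle[OF assms greedy_strategies(2) greedy_attains(2)]
  by (simp add: dice.optimal1_def)

lemma attains_min_optimal:
  assumes "\<phi> \<in> dice.strategies2" "attains_min \<phi> x"
  shows "dice.optimal2 \<phi>"
  using assms fixed_point_saddle[OF greedy_strategies(1) greedy_attains(1) assms]
  by (simp add: dice.optimal2_def)

end

theorem mainTheorem1:
  "dice.transient Final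
   \<and> (\<forall>s\<in>dice_states. dice.lower_value s = dice.upper_value s)
   \<and> (\<forall>x. (\<forall>s\<in>dice_states. x s = U x s) \<longleftrightarrow> (\<forall>s\<in>dice_states. x s = dice.val s))
   \<and> (\<exists>\<pi>. dice.pure \<pi> \<and> dice.stationary \<pi> \<and> dice.optimal1 \<pi>)
   \<and> (\<exists>\<phi>. dice.pure \<phi> \<and> dice.stationary \<phi> \<and> dice.optimal2 \<phi>)
   \<and> (\<forall>\<pi>\<in>dice.strategies1. dice.pure \<pi> \<and> dice.stationary \<pi> \<and> attains_max \<pi> dice.val
        \<longrightarrow> dice.optimal1 \<pi>)
   \<and> (\<forall>\<phi>\<in>dice.strategies2. dice.pure \<phi> \<and> dice.stationary \<phi> \<and> attains_min \<phi> dice.val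
        \<longrightarrow> dice.optimal2 \<phi>)"
proof (intro conjI)
  obtain v where v: "\<And>s. v s = U v s"
    using U_fixed_point_exists by blast
  note v_val = fixed_point_value[of v, OF v]
  \<comment> \<open>\<open>dice.val\<close> agrees with \<open>v\<close> on the states, and there
    \<open>U\<close> reads no other values, so the equation carries over from
    \<open>v\<close>.\<close>
  have val: "dice.val s = U dice.val s" if "s \<in> dice_states" for s
    using that U_cong[of s dice.val v] v v_val by (simp add: dice.val_def)
  show "dice.transient Final"
    by (rule transient_dice)
  show "\<forall>s\<in>dice_states. dice.lower_value s = dice.upper_value s"
    using v_val by simp
  show "\<forall>x. (\<forall>s\<in>dice_states. x s = U x s) \<longleftrightarrow> (\<forall>s\<in>dice_states. x s = dice.val s)"
  proof (intro allI iffI ballI)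
    fix x s assume "\<forall>s\<in>dice_states. x s = U x s" "s \<in> dice_states"
    then show "x s = dice.val s"
      using fixed_point_value(1)[of x s] by (simp add: dice.val_def)
  next
    fix x s assume "\<forall>s\<in>dice_states. x s = dice.val s" "s \<in> dice_states"
    then show "x s = U x s"
      using U_cong[of s x dice.val] val by simp
  qed
  show "\<exists>\<pi>. dice.pure \<pi> \<and> dice.stationary \<pi> \<and> dice.optimal1 \<pi>"
    using greedy_pure_stationary(1,2) attains_max_optimal[OF v greedy_strategies(1) greedy_attains(1)]
    by blast
  show "\<exists>\<phi>. dice.pure \<phi> \<and> dice.stationary \<phi> \<and> dice.optimal2 \<phi>"
    using greedy_pure_stationary(3,4) attains_min_optimal[OF v greedy_strategies(2) greedy_attains(2)]
    by blast
  show "\<forall>\<pi>\<in>dice.strategies1. dice.pure \<pi> \<and> dice.stationary \<pi> \<and> attains_max \<pi> dice.val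
        \<longrightarrow> dice.optimal1 \<pi>"
    using attains_max_optimal[OF val] by blast
  show "\<forall>\<phi>\<in>dice.strategies2. dice.pure \<phi> \<and> dice.stationary \<phi> \<and> attains_min \<phi> dice.val
        \<longrightarrow> dice.optimal2 \<phi>"
    using attains_min_optimal[OF val] by blast
qed

end
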